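(* Fix $h>1$ and $U>0$. For every $R>1$, let $\Psi_R\in H^1(\Omega_R)$ be a vector field satisfying $$ \nabla\cdot\Psi_R=0\ \text{ in }\Omega_R,\qquad \Psi_R=(U,0)\ \text{ on }\partial Q_R,\qquad \Psi_R=(0,0)\ \text{ on }\partial B_1 . $$ Then $$ \liminf_{R\to\infty}\ \frac{\|\nabla\Psi_R\|_{L^2(\Omega_R)}+\|\Psi_R\|_{L^4(\Omega_R)}}{\sqrt[4]{R}}>0 . $$
   Context: $Q_R=(-R,R)\times(-h,h)\subset\mathbb{R}^2$, $B_1$ is the open unit disk centered at the origin, and $\Omega_R=Q_R\setminus\overline{B_1}$; the half-height $h>1$ and the boundary speed $U>0$ are fixed, independent of $R$. Boundary values are in the trace sense. For vector fields $\Psi=(\Psi_1,\Psi_2)$, $\|\Psi\|_{L^4}$ is the $L^4$ norm of the Euclidean length $|\Psi|$ and $\|\nabla\Psi\|_{L^2}^2=\|\nabla\Psi_1\|_{L^2}^2+\|\nabla\Psi_2\|_{L^2}^2$. *)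

theory Defs
  imports "HOL-Analysis.Analysis"
begin

subsection \<open>Lebesgue norms\<close>

text \<open>The norm is extended-valued: it is \<open>\<infinity>\<close> when the integral of \<open>|f|^p\<close> diverges.\<close>

definition Lp_norm :: "real \<Rightarrow> 'a measure \<Rightarrow> ('a \<Rightarrow> 'b::real_normed_vector) \<Rightarrow> ennreal" where
  "Lp_norm p M f =
     (let I = (\<integral>\<^sup>+ x. ennreal (norm (f x) powr p) \<partial>M)
      in if I = \<infinity> then \<infinity> else ennreal (enn2real I powr (1 / p)))"

definition in_Lp :: "real \<Rightarrow> 'a measure \<Rightarrow> ('a \<Rightarrow> 'b::real_normed_vector) \<Rightarrow> bool" where
  "in_Lp p M f \<longleftrightarrow> f \<in> borel_measurable M \<and> Lp_norm p M f < \<infinity>"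

subsection \<open>Smooth functions and weak gradients\<close>

definition partial :: "('a::euclidean_space \<Rightarrow> real) \<Rightarrow> 'a \<Rightarrow> 'a \<Rightarrow> real" where
  "partial f i x = frechet_derivative f (at x) i"

definition grad :: "('a::euclidean_space \<Rightarrow> real) \<Rightarrow> 'a \<Rightarrow> 'a" where
  "grad f x = (\<Sum>i\<in>Basis. partial f i x *\<^sub>R i)"

primrec Ck :: "nat \<Rightarrow> ('a::euclidean_space \<Rightarrow> real) \<Rightarrow> bool" where
  "Ck 0 f \<longleftrightarrow> continuous_on UNIV f"
| "Ck (Suc k) f \<longleftrightarrow> (\<forall>x. f differentiable (at x)) \<and> (\<forall>i\<in>Basis. Ck k (partial f i))"

definition smooth :: "('a::euclidean_space \<Rightarrow> real) \<Rightarrow> bool" where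
  "smooth f \<longleftrightarrow> (\<forall>k. Ck k f)"

definition test_function :: "'a::euclidean_space set \<Rightarrow> ('a \<Rightarrow> real) \<Rightarrow> bool" where
  "test_function S \<phi> \<longleftrightarrow>
     smooth \<phi> \<and> compact (closure {x. \<phi> x \<noteq> 0}) \<and> closure {x. \<phi> x \<noteq> 0} \<subseteq> S"

definition locally_integrable_on ::
  "('a::euclidean_space \<Rightarrow> 'b::{banach, second_countable_topology}) \<Rightarrow> 'a set \<Rightarrow> bool" where
  "locally_integrable_on f S \<longleftrightarrow> (\<forall>K. compact K \<and> K \<subseteq> S \<longrightarrow> set_integrable lebesgue K f)"

definition has_weak_gradient ::
  "'a::euclidean_space set \<Rightarrow> ('a \<Rightarrow> real) \<Rightarrow> ('a \<Rightarrow> 'a) \<Rightarrow> bool" where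
  "has_weak_gradient S f G \<longleftrightarrow>
     locally_integrable_on f S \<and> locally_integrable_on G S \<and>
     (\<forall>\<phi> i. test_function S \<phi> \<and> i \<in> Basis \<longrightarrow>
        (LINT x:S|lebesgue. f x * partial \<phi> i x) = - (LINT x:S|lebesgue. (G x \<bullet> i) * \<phi> x))"

text \<open>On an open set the weak gradient is determined up to a null set, so the choice made here
  does not matter for anything defined below.\<close>

definition weak_grad :: "'a::euclidean_space set \<Rightarrow> ('a \<Rightarrow> real) \<Rightarrow> 'a \<Rightarrow> 'a" where
  "weak_grad S f = (SOME G. has_weak_gradient S f G)"

definition in_H1 :: "'a::euclidean_space set \<Rightarrow> ('a \<Rightarrow> real) \<Rightarrow> bool" where
  "in_H1 S f \<longleftrightarrow>
     in_Lp 2 (lebesgue_on S) f \<and> (\<exists>G. has_weak_gradient S f G) \<and>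
     in_Lp 2 (lebesgue_on S) (weak_grad S f)"

subsection \<open>Traces\<close>

text \<open>Integral with respect to arc length over the union of a list of non-overlapping curves,
  each parametrised over \<open>[0, 1]\<close>.\<close>

definition arc_length_nn_integral ::
  "(real \<Rightarrow> 'a::euclidean_space) list \<Rightarrow> ('a \<Rightarrow> ennreal) \<Rightarrow> ennreal" where
  "arc_length_nn_integral \<Gamma> F =
     (\<Sum>\<gamma>\<leftarrow>\<Gamma>. \<integral>\<^sup>+ t\<in>{0..1}. F (\<gamma> t) * ennreal (norm (vector_derivative \<gamma> (at t))) \<partial>lborel)"

text \<open>The trace operator \<open>H\<^sup>1(S) \<rightarrow> L\<^sup>2(\<Gamma>)\<close> is the continuous extension of the restriction map
  \<open>u \<mapsto> u|\<Gamma>\<close> from functions smooth up to the boundary of the bounded Lipschitz domain \<open>S\<close>, which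
  are dense. Accordingly \<open>g\<close> is the trace of \<open>f\<close> on the part \<open>\<Gamma>\<close> of the boundary iff
  some smooth functions converge to \<open>f\<close> in \<open>H\<^sup>1(S)\<close> while their restrictions to \<open>\<Gamma>\<close> converge to
  \<open>g\<close> in \<open>L\<^sup>2(\<Gamma>)\<close>.\<close>

definition has_trace ::
  "'a::euclidean_space set \<Rightarrow> (real \<Rightarrow> 'a) list \<Rightarrow> ('a \<Rightarrow> real) \<Rightarrow> ('a \<Rightarrow> real) \<Rightarrow> bool" where
  "has_trace S \<Gamma> f g \<longleftrightarrow>
     g \<in> borel_measurable borel \<and>
     (\<exists>u :: nat \<Rightarrow> 'a \<Rightarrow> real.
        (\<forall>n. smooth (u n)) \<and>
        (\<lambda>n. Lp_norm 2 (lebesgue_on S) (\<lambda>x. u n x - f x)) \<longlonglongrightarrow> 0 \<and>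
        (\<lambda>n. Lp_norm 2 (lebesgue_on S) (\<lambda>x. grad (u n) x - weak_grad S f x)) \<longlonglongrightarrow> 0 \<and>
        (\<lambda>n. arc_length_nn_integral \<Gamma> (\<lambda>x. ennreal ((u n x - g x)\<^sup>2))) \<longlonglongrightarrow> 0)"

subsection \<open>Planar vector fields\<close>

definition in_H1_field :: "(real \<times> real) set \<Rightarrow> (real \<times> real \<Rightarrow> real \<times> real) \<Rightarrow> bool" where
  "in_H1_field S \<Psi> \<longleftrightarrow> in_H1 S (\<lambda>x. fst (\<Psi> x)) \<and> in_H1 S (\<lambda>x. snd (\<Psi> x))"

definition has_trace_field ::
  "(real \<times> real) set \<Rightarrow> (real \<Rightarrow> real \<times> real) list \<Rightarrow>
   (real \<times> real \<Rightarrow> real \<times> real) \<Rightarrow> (real \<times> real \<Rightarrow> real \<times> real) \<Rightarrow> bool" where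
  "has_trace_field S \<Gamma> \<Psi> g \<longleftrightarrow>
     has_trace S \<Gamma> (\<lambda>x. fst (\<Psi> x)) (\<lambda>x. fst (g x)) \<and>
     has_trace S \<Gamma> (\<lambda>x. snd (\<Psi> x)) (\<lambda>x. snd (g x))"

definition weak_div :: "(real \<times> real) set \<Rightarrow> (real \<times> real \<Rightarrow> real \<times> real) \<Rightarrow> real \<times> real \<Rightarrow> real" where
  "weak_div S \<Psi> x = fst (weak_grad S (\<lambda>y. fst (\<Psi> y)) x) + snd (weak_grad S (\<lambda>y. snd (\<Psi> y)) x)"

text \<open>The norm of the pair of gradients is \<open>sqrt (|\<nabla>\<Psi>\<^sub>1|\<^sup>2 + |\<nabla>\<Psi>\<^sub>2|\<^sup>2)\<close>, so the squared \<open>L\<^sup>2\<close> norm of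
  \<open>weak_jacobian\<close> is the sum of the squared \<open>L\<^sup>2\<close> norms of \<open>\<nabla>\<Psi>\<^sub>1\<close> and \<open>\<nabla>\<Psi>\<^sub>2\<close>.\<close>

definition weak_jacobian ::
  "(real \<times> real) set \<Rightarrow> (real \<times> real \<Rightarrow> real \<times> real) \<Rightarrow> real \<times> real \<Rightarrow> (real \<times> real) \<times> (real \<times> real)" where
  "weak_jacobian S \<Psi> x = (weak_grad S (\<lambda>y. fst (\<Psi> y)) x, weak_grad S (\<lambda>y. snd (\<Psi> y)) x)"

subsection \<open>The domain\<close>

definition Q :: "real \<Rightarrow> real \<Rightarrow> (real \<times> real) set" where
  "Q h R = {-R<..<R} \<times> {-h<..<h}"

definition \<Omega> :: "real \<Rightarrow> real \<Rightarrow> (real \<times> real) set" where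
  "\<Omega> h R = Q h R - closure (ball 0 1)"

definition bdry_Q :: "real \<Rightarrow> real \<Rightarrow> (real \<Rightarrow> real \<times> real) list" where
  "bdry_Q h R =
     [linepath (-R, -h) (R, -h), linepath (R, -h) (R, h),
      linepath (R, h) (-R, h), linepath (-R, h) (-R, -h)]"

definition bdry_disk :: "(real \<Rightarrow> real \<times> real) list" where
  "bdry_disk = [\<lambda>t. (cos (2 * pi * t), sin (2 * pi * t))]"

end

theory Submission
  imports Defs
begin

text \<open>The flux of a divergence-free field with the given boundary values through every vertical
  section of \<open>D = (1, R) \<times> (-h, h)\<close> equals \<open>2 h U\<close>, so the integral of \<open>\<Psi>\<^sub>1\<close> over \<open>D\<close> is
  \<open>U |D|\<close>. To avoid sections of Sobolev functions, this is obtained by integrating the divergence of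
  the smooth approximations \<open>(u\<^sub>n, v\<^sub>n)\<close> against the weight \<open>x - 1\<close>, which vanishes on the side of
  \<open>D\<close> that is interior to the channel, and passing to the limit. Hoelder's inequality then gives
  \<open>(U |D|)^4 \<le> |D|^3 \<integral>|\<Psi>|^4\<close>, that is, the \<open>L\<^sup>4\<close> norm of \<open>\<Psi>\<close> is at least
  \<open>U root 4 |D|\<close>, and \<open>|D| = 2 h (R - 1)\<close> grows linearly in \<open>R\<close>.\<close>

section \<open>Integer powers of norms and Hoelder's inequality on a finite measure space\<close>

text \<open>Clears the root in the definition, so that norm estimates become inequalities between
  integrals in \<open>ennreal\<close>. The infinite case fits too, since
  \<open>\<infinity> ^ n = \<infinity>\<close> for \<open>n > 0\<close>.\<close>

lemma Lp_norm_power: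
  fixes f :: "'a \<Rightarrow> 'b::real_normed_vector"
  assumes "n > 0"
  shows "Lp_norm (real n) M f ^ n = (\<integral>\<^sup>+x. ennreal (norm (f x) ^ n) \<partial>M)"
proof -
  define I where "I = (\<integral>\<^sup>+ x. ennreal (norm (f x) powr real n) \<partial>M)"
  have I: "I = (\<integral>\<^sup>+x. ennreal (norm (f x) ^ n) \<partial>M)"
    unfolding I_def using assms by (intro nn_integral_cong) (simp add: powr_realpow')
  have "Lp_norm (real n) M f ^ n = I"
  proof (cases "I = \<infinity>")
    case True
    then show ?thesis
      using assms unfolding Lp_norm_def I_def[symmetric]
      by (simp add: power_eq_top_ennreal)
  next
    case False
    have "(enn2real I powr (1 / real n)) ^ n = enn2real I"
      using assms by (simp add: powr_powr flip: powr_realpow')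
    with False show ?thesis
      unfolding Lp_norm_def I_def[symmetric]
      by (simp add: ennreal_power less_top)
  qed
  then show ?thesis by (simp add: I)
qed

lemma Lp_norm_2_squared:
  "(Lp_norm 2 M f)\<^sup>2 = (\<integral>\<^sup>+x. ennreal ((norm (f x))\<^sup>2) \<partial>M)"
  using Lp_norm_power[of 2 M f] by simp

text \<open>Cauchy-Schwarz against the constant function 1.\<close>

lemma nn_integral_norm_squared_le:
  fixes f :: "'a \<Rightarrow> 'b::euclidean_space"
  assumes [measurable]: "f \<in> borel_measurable M"
  shows "(\<integral>\<^sup>+x. ennreal (norm (f x)) \<partial>M)\<^sup>2
    \<le> (\<integral>\<^sup>+x. ennreal ((norm (f x))\<^sup>2) \<partial>M) * emeasure M (space M)"
  using Cauchy_Schwarz_nn_integral[of "\<lambda>x. ennreal (norm (f x))" M "\<lambda>_. 1"]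
  by (simp add: ennreal_power)

text \<open>Hoelder with exponents 4 and 4/3 against the constant 1, obtained by using
  Cauchy-Schwarz twice: for |f| and then for |f|^2.\<close>

lemma nn_integral_norm_power4_le:
  fixes f :: "'a \<Rightarrow> 'b::euclidean_space"
  assumes [measurable]: "f \<in> borel_measurable M"
  shows "(\<integral>\<^sup>+x. ennreal (norm (f x)) \<partial>M) ^ 4
    \<le> (\<integral>\<^sup>+x. ennreal (norm (f x) ^ 4) \<partial>M) * emeasure M (space M) ^ 3"
proof -
  let ?m = "emeasure M (space M)"
  let ?I = "\<lambda>k. \<integral>\<^sup>+x. ennreal (norm (f x) ^ k) \<partial>M"
  have 1: "(?I 1)\<^sup>2 \<le> ?I 2 * ?m"
    using nn_integral_norm_squared_le[OF assms] by simp
  have 2: "(?I 2)\<^sup>2 \<le> ?I 4 * ?m"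
    using nn_integral_norm_squared_le[of "\<lambda>x. (norm (f x))\<^sup>2" M]
    by (simp flip: power_mult)
  have "?I 1 ^ 4 = ((?I 1)\<^sup>2)\<^sup>2"
    by (simp flip: power_mult)
  also have "\<dots> \<le> (?I 2 * ?m)\<^sup>2"
    using 1 by (intro power_mono) auto
  also have "\<dots> = (?I 2)\<^sup>2 * ?m\<^sup>2"
    by (simp add: power_mult_distrib)
  also have "\<dots> \<le> (?I 4 * ?m) * ?m\<^sup>2"
    using 2 by (intro mult_right_mono) auto
  also have "\<dots> = ?I 4 * ?m ^ 3"
    by (simp add: mult.assoc power3_eq_cube power2_eq_square)
  finally show ?thesis by simp
qed

section \<open>From L^2 to L^1 on sets of finite measure\<close>

lemma tendsto_0_le_ennreal:
  fixes f g :: "nat \<Rightarrow> ennreal"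
  assumes le: "\<And>n. f n \<le> g n" and g: "g \<longlonglongrightarrow> 0"
  shows "f \<longlonglongrightarrow> 0"
  by (rule tendsto_sandwich[OF _ _ tendsto_const g]) (simp_all add: le)

lemma (in finite_measure) integral_norm_tendsto_0:
  fixes f :: "nat \<Rightarrow> 'a \<Rightarrow> 'b::euclidean_space"
  assumes [measurable]: "\<And>n. f n \<in> borel_measurable M"
    and lim: "(\<lambda>n. \<integral>\<^sup>+x. ennreal ((norm (f n x))\<^sup>2) \<partial>M) \<longlonglongrightarrow> 0"
  shows "(\<lambda>n. LINT x|M. norm (f n x)) \<longlonglongrightarrow> 0"
proof -
  define X where "X n = (\<integral>\<^sup>+x. ennreal (norm (f n x)) \<partial>M)" for n
  have le: "(X n)\<^sup>2 \<le> (\<integral>\<^sup>+x. ennreal ((norm (f n x))\<^sup>2) \<partial>M) * emeasure M (space M)" for n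
    unfolding X_def by (rule nn_integral_norm_squared_le) fact
  have "(\<lambda>n. (\<integral>\<^sup>+x. ennreal ((norm (f n x))\<^sup>2) \<partial>M) * emeasure M (space M))
      \<longlonglongrightarrow> 0 * emeasure M (space M)"
    using emeasure_finite by (intro tendsto_mult_ennreal lim tendsto_const) auto
  then have "(\<lambda>n. (X n)\<^sup>2) \<longlonglongrightarrow> 0"
    using tendsto_0_le_ennreal[OF le] by simp
  \<comment> \<open>The first few \<open>X n\<close> may be infinite. This is harmless:
    \<open>enn2real\<close> is continuous at the finite limit 0, and it sends
    \<open>\<infinity>\<close> to 0, which is also the Bochner integral of a non-integrable
    function.\<close>
  then have "(\<lambda>n. enn2real ((X n)\<^sup>2)) \<longlonglongrightarrow> enn2real 0"
    by (intro tendsto_enn2real) auto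
  then have "(\<lambda>n. sqrt ((enn2real (X n))\<^sup>2)) \<longlonglongrightarrow> sqrt 0"
    by (intro tendsto_real_sqrt) (simp add: power2_eq_square enn2real_mult)
  then show ?thesis
    by (simp add: X_def integral_eq_nn_integral)
qed

lemma nn_integral_lebesgue_on_mono:
  assumes "S \<in> sets lebesgue" "D \<in> sets lebesgue" "D \<subseteq> S"
  shows "(\<integral>\<^sup>+x. f x \<partial>lebesgue_on D) \<le> (\<integral>\<^sup>+x. f x \<partial>lebesgue_on S)"
  using assms by (auto simp: nn_integral_restrict_space intro!: nn_integral_mono
      split: split_indicator)

text \<open>Turns the convergence that \<open>has_trace\<close> provides on the whole domain into
  L^1 convergence on a subset of finite measure, where it can be combined with integrals of the
  limit.\<close>

lemma integral_norm_tendsto_0_if_Lp_norm_2: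
  fixes f :: "nat \<Rightarrow> 'a::euclidean_space \<Rightarrow> 'b::euclidean_space"
  assumes f: "\<And>n. f n \<in> borel_measurable (lebesgue_on S)"
    and S: "S \<in> sets lebesgue" and D: "D \<in> lmeasurable" "D \<subseteq> S"
    and lim: "(\<lambda>n. Lp_norm 2 (lebesgue_on S) (f n)) \<longlonglongrightarrow> 0"
  shows "(\<lambda>n. LINT x|lebesgue_on D. norm (f n x)) \<longlonglongrightarrow> 0"
proof -
  interpret finite_measure "lebesgue_on D"
    using D by (intro finite_measure_lebesgue_on)
  have "(\<lambda>n. Lp_norm 2 (lebesgue_on S) (f n) * Lp_norm 2 (lebesgue_on S) (f n)) \<longlonglongrightarrow> 0 * 0"
    using lim by (intro tendsto_mult_ennreal) auto
  then have lim2: "(\<lambda>n. \<integral>\<^sup>+x. ennreal ((norm (f n x))\<^sup>2) \<partial>lebesgue_on S) \<longlonglongrightarrow> 0"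
    by (simp add: Lp_norm_2_squared flip: power2_eq_square)
  have le: "(\<integral>\<^sup>+x. ennreal ((norm (f n x))\<^sup>2) \<partial>lebesgue_on D)
      \<le> (\<integral>\<^sup>+x. ennreal ((norm (f n x))\<^sup>2) \<partial>lebesgue_on S)" for n
    using S D by (intro nn_integral_lebesgue_on_mono) (auto simp: fmeasurableD)
  have "(\<lambda>n. \<integral>\<^sup>+x. ennreal ((norm (f n x))\<^sup>2) \<partial>lebesgue_on D) \<longlonglongrightarrow> 0"
    by (rule tendsto_0_le_ennreal[OF le lim2])
  then show ?thesis
    using measurable_restrict_mono[OF f D(2)] by (intro integral_norm_tendsto_0)
qed

text \<open>L^2 embeds into L^1 on a set of finite measure. This makes the field and its weak
  gradients integrable on \<open>D\<close>, so that the integral is linear there.\<close>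

lemma integrable_subset_if_in_Lp_2:
  fixes f :: "'a::euclidean_space \<Rightarrow> 'b::euclidean_space"
  assumes f: "in_Lp 2 (lebesgue_on S) f"
    and S: "S \<in> sets lebesgue" and D: "D \<in> lmeasurable" "D \<subseteq> S"
  shows "integrable (lebesgue_on D) f"
proof -
  interpret finite_measure "lebesgue_on D"
    using D by (intro finite_measure_lebesgue_on)
  have m: "f \<in> borel_measurable (lebesgue_on D)"
    using f D(2) measurable_restrict_mono unfolding in_Lp_def by blast
  have "(\<integral>\<^sup>+x. ennreal ((norm (f x))\<^sup>2) \<partial>lebesgue_on D)
      \<le> (\<integral>\<^sup>+x. ennreal ((norm (f x))\<^sup>2) \<partial>lebesgue_on S)"
    using S D by (intro nn_integral_lebesgue_on_mono) (auto simp: fmeasurableD)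
  also have "\<dots> = (Lp_norm 2 (lebesgue_on S) f)\<^sup>2"
    by (simp add: Lp_norm_2_squared)
  also have "\<dots> < \<infinity>"
    using f by (simp add: in_Lp_def power_less_top_ennreal)
  finally have "integrable (lebesgue_on D) (\<lambda>x. (norm (f x))\<^sup>2)"
    using m by (intro integrableI_bounded) auto
  then have "integrable (lebesgue_on D) (\<lambda>x. norm (f x))"
    using m square_integrable_imp_integrable[of "\<lambda>x. norm (f x)"] by simp
  then show ?thesis
    by (rule integrable_norm_cancel) (rule m)
qed

section \<open>Calculus of smooth functions and a weighted divergence identity\<close>

lemma smooth_imp_continuous_on: "continuous_on A f" if "smooth f"
proof -
  have "Ck 0 f" using that by (simp add: smooth_def)
  then show ?thesis using continuous_on_subset by fastforce
qed

lemma smooth_imp_differentiable: "f differentiable (at x)" if "smooth f"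
proof -
  have "Ck (Suc 0) f" using that by (simp only: smooth_def)
  then show ?thesis by simp
qed

lemma smooth_imp_continuous_on_partial: "continuous_on A (partial f i)" if "smooth f" "i \<in> Basis"
proof -
  have "Ck (Suc 0) f" using that by (simp only: smooth_def)
  then show ?thesis using continuous_on_subset that by fastforce
qed

lemma smooth_imp_continuous_on_grad: "continuous_on A (grad f)" if "smooth f"
  unfolding grad_def
  using that by (auto intro!: continuous_intros smooth_imp_continuous_on_partial)

lemma grad_plane: "grad f p = (partial f (1, 0) p, partial f (0, 1) p)"
  for f :: "real \<times> real \<Rightarrow> real"
  by (simp add: grad_def Basis_prod_def sum.union_disjoint image_iff prod_eq_iff)

lemma smooth_has_real_derivative_fst:
  fixes f :: "real \<times> real \<Rightarrow> real"
  assumes "smooth f"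
  shows "((\<lambda>x. f (x, y)) has_real_derivative partial f (1, 0) (x, y)) (at x within A)"
proof -
  let ?D = "frechet_derivative f (at (x, y))"
  have D: "(f has_derivative ?D) (at (x, y))"
    using smooth_imp_differentiable[OF assms] by (simp flip: frechet_derivative_works)
  have "((\<lambda>x. f (x, y)) has_derivative (\<lambda>s. ?D (s, 0))) (at x within A)"
    by (rule has_derivative_compose[of "\<lambda>x. (x, y)", OF _ D]) (auto intro!: derivative_eq_intros)
  moreover have "(\<lambda>s. ?D (s, 0)) = (*) (partial f (1, 0) (x, y))"
  proof
    fix s
    show "?D (s, 0) = partial f (1, 0) (x, y) * s"
      using linear_scale[OF has_derivative_linear[OF D], of s "(1, 0)"]
      by (simp add: partial_def mult.commute)
  qed
  ultimately show ?thesis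
    by (simp only: has_field_derivative_def)
qed

lemma smooth_has_real_derivative_snd:
  fixes f :: "real \<times> real \<Rightarrow> real"
  assumes "smooth f"
  shows "((\<lambda>y. f (x, y)) has_real_derivative partial f (0, 1) (x, y)) (at y within A)"
proof -
  let ?D = "frechet_derivative f (at (x, y))"
  have D: "(f has_derivative ?D) (at (x, y))"
    using smooth_imp_differentiable[OF assms] by (simp flip: frechet_derivative_works)
  have "((\<lambda>y. f (x, y)) has_derivative (\<lambda>s. ?D (0, s))) (at y within A)"
    by (rule has_derivative_compose[of "\<lambda>y. (x, y)", OF _ D]) (auto intro!: derivative_eq_intros)
  moreover have "(\<lambda>s. ?D (0, s)) = (*) (partial f (0, 1) (x, y))"
  proof
    fix s
    show "?D (0, s) = partial f (0, 1) (x, y) * s"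
      using linear_scale[OF has_derivative_linear[OF D], of s "(0, 1)"]
      by (simp add: partial_def mult.commute)
  qed
  ultimately show ?thesis
    by (simp only: has_field_derivative_def)
qed

text \<open>The divergence theorem for the field (x - a) (u, v) on a rectangle. The weight vanishes
  on the left side, so only the right, top and bottom sides contribute.\<close>

lemma integral_weighted_divergence:
  fixes u v :: "real \<times> real \<Rightarrow> real"
  assumes u: "smooth u" and v: "smooth v" and "a \<le> b" "c \<le> d"
  shows "integral (cbox (a, c) (b, d))
      (\<lambda>p. u p + (fst p - a) * (fst (grad u p) + snd (grad v p)))
    = (b - a) * integral {c..d} (\<lambda>y. u (b, y))
      + integral {a..b} (\<lambda>x. (x - a) * (v (x, d) - v (x, c)))"
proof -
  let ?B = "cbox (a, c) (b, d)"
  let ?f = "\<lambda>p. u p + (fst p - a) * partial u (1, 0) p"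
  let ?g = "\<lambda>p. (fst p - a) * partial v (0, 1) p"
  have B: "(1::real, 0::real) \<in> Basis" "(0::real, 1::real) \<in> Basis"
    by (auto simp: Basis_prod_def)
  have cf: "continuous_on ?B ?f" and cg: "continuous_on ?B ?g"
    by (intro continuous_intros smooth_imp_continuous_on smooth_imp_continuous_on_partial u v B)+
  have "integral ?B ?f = integral (cbox a b) (\<lambda>x. integral (cbox c d) (\<lambda>y. ?f (x, y)))"
    by (rule integral_prod_continuous[OF cf])
  \<comment> \<open>The inner integral must run over x here, because \<open>?f\<close> is the
    x-derivative of (x - a) u.\<close>
  also have "\<dots> = integral (cbox c d) (\<lambda>y. integral (cbox a b) (\<lambda>x. ?f (x, y)))"
    using cf by (intro integral_swap_continuous) (simp add: case_prod_beta')
  also have "\<dots> = integral {c..d} (\<lambda>y. (b - a) * u (b, y))"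
  proof -
    have "((\<lambda>x. ?f (x, y)) has_integral (b - a) * u (b, y) - (a - a) * u (a, y)) {a..b}" for y
      using \<open>a \<le> b\<close>
      by (intro fundamental_theorem_of_calculus)
        (auto intro!: derivative_eq_intros smooth_has_real_derivative_fst[OF u]
          simp flip: has_real_derivative_iff_has_vector_derivative)
    then have eq: "integral {a..b} (\<lambda>x. ?f (x, y)) = (b - a) * u (b, y)" for y
      by (simp add: integral_unique)
    show ?thesis by (simp only: eq cbox_interval)
  qed
  finally have 1: "integral ?B ?f = (b - a) * integral {c..d} (\<lambda>y. u (b, y))"
    by simp
  have "integral ?B ?g = integral (cbox a b) (\<lambda>x. integral (cbox c d) (\<lambda>y. ?g (x, y)))"
    by (rule integral_prod_continuous[OF cg])
  also have "\<dots> = integral {a..b} (\<lambda>x. (x - a) * (v (x, d) - v (x, c)))"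
  proof -
    have fi: "((\<lambda>y. partial v (0, 1) (x, y)) has_integral v (x, d) - v (x, c)) {c..d}" for x
      using \<open>c \<le> d\<close>
      by (intro fundamental_theorem_of_calculus)
        (auto intro!: smooth_has_real_derivative_snd[OF v]
          simp flip: has_real_derivative_iff_has_vector_derivative)
    have eq: "integral {c..d} (\<lambda>y. ?g (x, y)) = (x - a) * (v (x, d) - v (x, c))" for x
      using has_integral_mult_right[OF fi, of "x - a" x] by (intro integral_unique) (simp only: fst_conv)
    show ?thesis by (simp only: eq cbox_interval)
  qed
  finally have 2: "integral ?B ?g = integral {a..b} (\<lambda>x. (x - a) * (v (x, d) - v (x, c)))" .
  have "integral ?B (\<lambda>p. ?f p + ?g p) = integral ?B ?f + integral ?B ?g"
    using cf cg by (intro integral_add integrable_continuous)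
  moreover have "(\<lambda>p. u p + (fst p - a) * (fst (grad u p) + snd (grad v p))) = (\<lambda>p. ?f p + ?g p)"
    by (simp add: grad_plane algebra_simps)
  ultimately show ?thesis
    by (simp only: 1 2)
qed

section \<open>Traces on the sides of the rectangle\<close>

text \<open>Affine change of variables, with \<open>\<bar>r - p\<bar>\<close> as the speed of the
  path. The case \<open>r < p\<close> is included because \<open>bdry_Q\<close> traverses two of its
  sides in the decreasing direction.\<close>

lemma nn_integral_linepath:
  fixes F :: "real \<Rightarrow> ennreal"
  assumes [measurable]: "F \<in> borel_measurable borel" and "p \<noteq> r"
  shows "(\<integral>\<^sup>+t\<in>{0..1}. F (linepath p r t) * ennreal \<bar>r - p\<bar> \<partial>lborel)
    = (\<integral>\<^sup>+x. F x \<partial>lebesgue_on {min p r..max p r})"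
proof -
  let ?I = "{min p r..max p r}"
  have lp: "linepath p r t = p + (r - p) * t" for t
    by (simp add: linepath_def algebra_simps)
  \<comment> \<open>The substitution pulls the segment back to the unit interval. The two
    orientations are separate cases since multiplying by a negative \<open>r - p\<close> reverses
    inequalities.\<close>
  have ind: "indicator ?I (p + (r - p) * t) = (indicator {0..1} t :: ennreal)" for t
  proof -
    have "p + (r - p) * t \<in> ?I \<longleftrightarrow> t \<in> {0..1}"
    proof (cases "p < r")
      case True
      then have m: "min p r = p" "max p r = r" by auto
      have "p \<le> p + (r - p) * t \<longleftrightarrow> (r - p) * 0 \<le> (r - p) * t"
        "p + (r - p) * t \<le> r \<longleftrightarrow> (r - p) * t \<le> (r - p) * 1"
        by (auto simp: algebra_simps)
      then show ?thesis
        using True by (simp only: m atLeastAtMost_iff mult_le_cancel_left_pos diff_gt_0_iff_gt)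
    next
      case False
      with \<open>p \<noteq> r\<close> have "r < p" by simp
      then have m: "min p r = r" "max p r = p" by auto
      have "p + (r - p) * t \<le> p \<longleftrightarrow> (r - p) * t \<le> (r - p) * 0"
        "r \<le> p + (r - p) * t \<longleftrightarrow> (r - p) * 1 \<le> (r - p) * t"
        by (auto simp: algebra_simps)
      then show ?thesis
        using \<open>r < p\<close>
        by (simp only: m atLeastAtMost_iff mult_le_cancel_left_neg diff_less_0_iff_less conj_commute)
    qed
    then show ?thesis by (simp add: indicator_def)
  qed
  have "(\<integral>\<^sup>+x. F x \<partial>lebesgue_on ?I) = (\<integral>\<^sup>+x. F x * indicator ?I x \<partial>lborel)"
    by (simp add: nn_integral_restrict_space nn_integral_completion)
  also have "\<dots> = \<bar>r - p\<bar> * (\<integral>\<^sup>+t. F (p + (r - p) * t) * indicator ?I (p + (r - p) * t) \<partial>lborel)"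
    using \<open>p \<noteq> r\<close> by (intro nn_integral_real_affine) auto
  also have "\<dots> = (\<integral>\<^sup>+t\<in>{0..1}. F (linepath p r t) * ennreal \<bar>r - p\<bar> \<partial>lborel)"
    unfolding lp by (subst nn_integral_cmult[symmetric]) (simp_all only: ind, simp_all add: ac_simps)
  finally show ?thesis by simp
qed

lemma arc_length_nn_integral_member_le:
  assumes "\<gamma> \<in> set \<Gamma>"
  shows "(\<integral>\<^sup>+t\<in>{0..1}. F (\<gamma> t) * ennreal (norm (vector_derivative \<gamma> (at t))) \<partial>lborel)
    \<le> arc_length_nn_integral \<Gamma> F"
  unfolding arc_length_nn_integral_def using assms by (intro member_le_sum_list) auto

text \<open>The map \<open>e\<close> is an isometric parametrisation of the line carrying one side,
  and \<open>k\<close> is the constant boundary value. The integral over that side is at most the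
  integral over all of \<open>\<Gamma>\<close>, and L^2 convergence on a segment gives L^1
  convergence.\<close>

lemma integral_segment_tendsto_0:
  fixes u :: "nat \<Rightarrow> 'a::euclidean_space \<Rightarrow> real" and e :: "real \<Rightarrow> 'a"
  assumes u: "\<And>n. smooth (u n)"
    and lim: "(\<lambda>n. arc_length_nn_integral \<Gamma> (\<lambda>x. ennreal ((u n x - k)\<^sup>2))) \<longlonglongrightarrow> 0"
    and e: "continuous_on UNIV e" and "p \<noteq> r"
    and mem: "linepath (e p) (e r) \<in> set \<Gamma>"
    and lin: "\<And>t. linepath (e p) (e r) t = e (linepath p r t)" and iso: "\<And>x y. norm (e x - e y) = \<bar>x - y\<bar>"
  shows "(\<lambda>n. integral {min p r..max p r} (\<lambda>x. \<bar>u n (e x) - k\<bar>)) \<longlonglongrightarrow> 0"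
proof -
  let ?I = "{min p r..max p r}"
  interpret finite_measure "lebesgue_on ?I"
    by (intro finite_measure_lebesgue_on) simp
  have c: "continuous_on UNIV (\<lambda>x. u n (e x) - k)" for n
    using continuous_on_compose2[OF smooth_imp_continuous_on[OF u] e]
    by (intro continuous_intros) auto
  have [measurable]: "(\<lambda>x. u n (e x) - k) \<in> borel_measurable borel" for n
    using c by (rule borel_measurable_continuous_onI)
  have "(\<integral>\<^sup>+x. ennreal ((u n (e x) - k)\<^sup>2) \<partial>lebesgue_on ?I)
      \<le> arc_length_nn_integral \<Gamma> (\<lambda>x. ennreal ((u n x - k)\<^sup>2))" for n
  proof -
    have "(\<integral>\<^sup>+x. ennreal ((u n (e x) - k)\<^sup>2) \<partial>lebesgue_on ?I)
      = (\<integral>\<^sup>+t\<in>{0..1}. ennreal ((u n (e (linepath p r t)) - k)\<^sup>2) * ennreal \<bar>r - p\<bar> \<partial>lborel)"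
      using \<open>p \<noteq> r\<close> by (intro nn_integral_linepath[symmetric]) measurable
    also have "\<dots> \<le> arc_length_nn_integral \<Gamma> (\<lambda>x. ennreal ((u n x - k)\<^sup>2))"
      using arc_length_nn_integral_member_le[OF mem, of "\<lambda>x. ennreal ((u n x - k)\<^sup>2)"]
      by (simp add: lin iso)
    finally show ?thesis .
  qed
  then have "(\<lambda>n. \<integral>\<^sup>+x. ennreal ((u n (e x) - k)\<^sup>2) \<partial>lebesgue_on ?I) \<longlonglongrightarrow> 0"
    by (rule tendsto_0_le_ennreal[OF _ lim])
  moreover have "(\<lambda>x. u n (e x) - k) \<in> borel_measurable (lebesgue_on ?I)" for n
    by (intro measurable_restrict_space1 measurable_completion) measurable
  ultimately have "(\<lambda>n. LINT x|lebesgue_on ?I. \<bar>u n (e x) - k\<bar>) \<longlonglongrightarrow> 0"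
    using integral_norm_tendsto_0[of "\<lambda>n x. u n (e x) - k"] by simp
  moreover have "(LINT x|lebesgue_on ?I. \<bar>u n (e x) - k\<bar>) = integral ?I (\<lambda>x. \<bar>u n (e x) - k\<bar>)" for n
    using continuous_on_subset[OF c]
    by (intro lebesgue_integral_eq_integral continuous_imp_integrable_real continuous_on_rabs) auto
  ultimately show ?thesis by simp
qed

section \<open>Integration over the part of the channel to the right of the disk\<close>

text \<open>Links the open box, which lies inside the domain, to the closed box used by the
  divergence identity; they differ by a null set.\<close>

lemma continuous_box_integral:
  fixes f :: "'a::euclidean_space \<Rightarrow> 'b::euclidean_space"
  assumes "continuous_on UNIV f"
  shows continuous_imp_integrable_box: "integrable (lebesgue_on (box a b)) f"
    and continuous_LINT_box: "(LINT x|lebesgue_on (box a b). f x) = integral (cbox a b) f"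
proof -
  have "f absolutely_integrable_on cbox a b"
    by (rule absolutely_integrable_continuous[OF continuous_on_subset[OF assms subset_UNIV]])
  then have "f absolutely_integrable_on box a b"
    by (rule set_integrable_subset) (auto simp: box_subset_cbox)
  then show 1: "integrable (lebesgue_on (box a b)) f"
    by (simp add: integrable_restrict_space set_integrable_def)
  show "(LINT x|lebesgue_on (box a b). f x) = integral (cbox a b) f"
    by (subst lebesgue_integral_eq_integral[OF 1]) (simp_all add: integral_open_interval)
qed

lemma box_plane: "box (a, c) (b, d) = {a<..<b} \<times> {c<..<d}" for a b c d :: real
  by (auto simp: mem_box Basis_prod_def ball_Un)

lemma \<Omega>_sets_lebesgue: "\<Omega> h R \<in> sets lebesgue"
  unfolding \<Omega>_def Q_def by (intro sets_completionI_sets) (auto intro!: borel_open open_Times)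

text \<open>Points with first coordinate above 1 have norm above 1, hence avoid the closed
  disk.\<close>

lemma box_subset_\<Omega>: "box (1, -h) (R, h) \<subseteq> \<Omega> h R"
proof
  fix p :: "real \<times> real"
  assume "p \<in> box (1, -h) (R, h)"
  moreover have "\<bar>fst p\<bar> \<le> norm p"
    using norm_fst_le[of "fst p" "snd p"] by simp
  ultimately show "p \<in> \<Omega> h R"
    by (auto simp: box_plane \<Omega>_def Q_def mem_Times_iff)
qed

section \<open>The mean horizontal velocity\<close>

text \<open>In the limit of the weighted identity the right side of the rectangle contributes (R -
  1) 2 h U, while the top and bottom contribute 0 because the second component vanishes
  there.\<close>

lemma flux:
  fixes h U R :: real and \<Psi> :: "real \<times> real \<Rightarrow> real \<times> real"
  assumes "h > 0" and "R > 1"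
    and H1: "in_H1_field (\<Omega> h R) \<Psi>"
    and div: "AE x in lebesgue_on (\<Omega> h R). weak_div (\<Omega> h R) \<Psi> x = 0"
    and trace: "has_trace_field (\<Omega> h R) (bdry_Q h R) \<Psi> (\<lambda>_. (U, 0))"
  defines "D \<equiv> box (1, -h) (R, h)"
  shows "(LINT x|lebesgue_on D. fst (\<Psi> x)) = U * (2 * h * (R - 1))"
proof -
  let ?S = "\<Omega> h R"
  define f where "f = (\<lambda>x. fst (\<Psi> x))"
  define g where "g = (\<lambda>x. snd (\<Psi> x))"
  define f' where "f' = weak_grad ?S f"
  define g' where "g' = weak_grad ?S g"
  have S: "?S \<in> sets lebesgue" by (rule \<Omega>_sets_lebesgue)
  have D: "D \<in> lmeasurable" unfolding D_def by simp
  have DS: "D \<subseteq> ?S" unfolding D_def by (rule box_subset_\<Omega>)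
  have f: "in_Lp 2 (lebesgue_on ?S) f" "in_Lp 2 (lebesgue_on ?S) f'"
    and g: "in_Lp 2 (lebesgue_on ?S) g" "in_Lp 2 (lebesgue_on ?S) g'"
    using H1 by (auto simp: in_H1_field_def in_H1_def f_def g_def f'_def g'_def)
  \<comment> \<open>The two components are approximated independently, so (u n, v n) need not be
    divergence-free; its divergence is controlled only through that of the limit.\<close>
  obtain u where u: "\<And>n. smooth (u n)"
    and uf: "(\<lambda>n. Lp_norm 2 (lebesgue_on ?S) (\<lambda>x. u n x - f x)) \<longlonglongrightarrow> 0"
    and uf': "(\<lambda>n. Lp_norm 2 (lebesgue_on ?S) (\<lambda>x. grad (u n) x - f' x)) \<longlonglongrightarrow> 0"
    and uU: "(\<lambda>n. arc_length_nn_integral (bdry_Q h R) (\<lambda>x. ennreal ((u n x - U)\<^sup>2))) \<longlonglongrightarrow> 0"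
    using trace unfolding has_trace_field_def has_trace_def f_def f'_def by auto
  obtain v where v: "\<And>n. smooth (v n)"
    and vg': "(\<lambda>n. Lp_norm 2 (lebesgue_on ?S) (\<lambda>x. grad (v n) x - g' x)) \<longlonglongrightarrow> 0"
    and v0: "(\<lambda>n. arc_length_nn_integral (bdry_Q h R) (\<lambda>x. ennreal ((v n x - 0)\<^sup>2))) \<longlonglongrightarrow> 0"
    using trace unfolding has_trace_field_def has_trace_def g_def g'_def by auto
  have meas: "w \<in> borel_measurable (lebesgue_on A)" if "continuous_on UNIV w"
    for w :: "real \<times> real \<Rightarrow> 'b::topological_space" and A
    using borel_measurable_continuous_onI[OF that]
    by (intro measurable_restrict_space1 measurable_completion) simp
  note cont = smooth_imp_continuous_on[OF u, of UNIV] smooth_imp_continuous_on[OF v, of UNIV]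
    smooth_imp_continuous_on_grad[OF u, of UNIV] smooth_imp_continuous_on_grad[OF v, of UNIV]
  have [measurable]: "f \<in> borel_measurable (lebesgue_on ?S)" "f' \<in> borel_measurable (lebesgue_on ?S)"
    "g' \<in> borel_measurable (lebesgue_on ?S)"
    using f g by (auto simp: in_Lp_def)
  note [measurable] = cont[THEN meas]
  \<comment> \<open>\<open>A\<close>, \<open>B\<close> and \<open>C\<close> measure the errors
    inside \<open>D\<close>; \<open>E\<close>, \<open>T\<close> and \<open>L\<close> those on the
    right, top and bottom sides.\<close>
  define A where "A n = (LINT x|lebesgue_on D. norm (u n x - f x))" for n
  define B where "B n = (LINT x|lebesgue_on D. norm (grad (u n) x - f' x))" for n
  define C where "C n = (LINT x|lebesgue_on D. norm (grad (v n) x - g' x))" for n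
  define E where "E n = integral {-h..h} (\<lambda>y. \<bar>u n (R, y) - U\<bar>)" for n
  define T where "T n = integral {-R..R} (\<lambda>x. \<bar>v n (x, h)\<bar>)" for n
  define L where "L n = integral {-R..R} (\<lambda>x. \<bar>v n (x, -h)\<bar>)" for n
  have A: "A \<longlonglongrightarrow> 0" unfolding A_def
    by (rule integral_norm_tendsto_0_if_Lp_norm_2[OF _ S D DS uf]) measurable
  have B: "B \<longlonglongrightarrow> 0" unfolding B_def
    by (rule integral_norm_tendsto_0_if_Lp_norm_2[OF _ S D DS uf']) measurable
  have C: "C \<longlonglongrightarrow> 0" unfolding C_def
    by (rule integral_norm_tendsto_0_if_Lp_norm_2[OF _ S D DS vg']) measurable
  have "(\<lambda>n. integral {min (-h) (h)..max (-h) (h)} (\<lambda>y. \<bar>u n (R, y) - U\<bar>)) \<longlonglongrightarrow> 0"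
    using \<open>h > 0\<close>
    by (intro integral_segment_tendsto_0[OF u uU])
      (auto simp: bdry_Q_def linepath_def norm_Pair algebra_simps intro!: continuous_intros)
  then have E: "E \<longlonglongrightarrow> 0"
    using \<open>h > 0\<close> by (simp add: E_def[abs_def])
  have "(\<lambda>n. integral {min (-R) (R)..max (-R) (R)} (\<lambda>x. \<bar>v n (x, -h) - 0\<bar>)) \<longlonglongrightarrow> 0"
    using \<open>R > 1\<close>
    by (intro integral_segment_tendsto_0[OF v v0])
      (auto simp: bdry_Q_def linepath_def norm_Pair algebra_simps intro!: continuous_intros)
  then have L: "L \<longlonglongrightarrow> 0"
    using \<open>R > 1\<close> by (simp add: L_def[abs_def])
  \<comment> \<open>The top side runs from right to left, hence the reversed endpoints.\<close>
  have "(\<lambda>n. integral {min (R) (-R)..max (R) (-R)} (\<lambda>x. \<bar>v n (x, h) - 0\<bar>)) \<longlonglongrightarrow> 0"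
    using \<open>R > 1\<close>
    by (intro integral_segment_tendsto_0[OF v v0])
      (auto simp: bdry_Q_def linepath_def norm_Pair algebra_simps intro!: continuous_intros)
  then have T: "T \<longlonglongrightarrow> 0"
    using \<open>R > 1\<close> by (simp add: T_def[abs_def])
  \<comment> \<open>The defect \<open>d\<close> does not depend on \<open>n\<close>; it vanishes
    once it is bounded by errors that tend to 0.\<close>
  define d where "d = U * (2 * h * (R - 1)) - (LINT x|lebesgue_on D. f x)"
  have "\<bar>d\<bar> \<le> (A n + (R - 1) * (B n + C n)) + (R - 1) * E n + (R - 1) * (T n + L n)" for n
  proof -
    define w where "w = (\<lambda>p::real \<times> real. (fst p - 1) * (fst (grad (u n) p) + snd (grad (v n) p)))"
    define I1 where "I1 = integral {-h..h} (\<lambda>y. u n (R, y))"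
    define I2 where "I2 = integral {1..R} (\<lambda>x. (x - 1) * (v n (x, h) - v n (x, -h)))"
    have w: "continuous_on UNIV w"
      unfolding w_def by (intro continuous_intros cont)
    have uw: "continuous_on UNIV (\<lambda>p. u n p + w p)"
      by (intro continuous_intros cont w)
    have cu: "continuous_on X (\<lambda>y. u n (R, y))" and cv: "continuous_on X (\<lambda>x. v n (x, c))" for X c
      by (auto intro!: continuous_on_compose2[OF cont(1)] continuous_on_compose2[OF cont(2)]
          continuous_intros)
    have int: "integrable (lebesgue_on D) f" "integrable (lebesgue_on D) f'"
        "integrable (lebesgue_on D) g'"
      by (intro integrable_subset_if_in_Lp_2[OF _ S D DS] f g)+
    have iu: "integrable (lebesgue_on D) (u n)" and iw: "integrable (lebesgue_on D) w"
      and iuw: "integrable (lebesgue_on D) (\<lambda>p. u n p + w p)"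
      unfolding D_def by (intro continuous_imp_integrable_box w uw cont)+
    have igrad: "integrable (lebesgue_on D) (grad (u n))" "integrable (lebesgue_on D) (grad (v n))"
      unfolding D_def by (intro continuous_imp_integrable_box cont)+
    have "(LINT p|lebesgue_on D. u n p + w p) = (R - 1) * I1 + I2"
      using integral_weighted_divergence[OF u v, of 1 R "-h" h n n] \<open>h > 0\<close> \<open>R > 1\<close>
        continuous_LINT_box[OF uw]
      by (simp add: D_def w_def I1_def I2_def)
    \<comment> \<open>The defect splits into an interior error, an error on the right side, and the
      contribution of the top and bottom.\<close>
    then have "d = (LINT p|lebesgue_on D. u n p + w p - f p) - (R - 1) * (I1 - 2 * h * U) - I2"
      using iuw int(1) by (simp add: d_def algebra_simps)
    moreover have "\<bar>LINT p|lebesgue_on D. u n p + w p - f p\<bar> \<le> A n + (R - 1) * (B n + C n)"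
    proof -
      have "AE p in lebesgue_on D. weak_div ?S \<Psi> p = 0"
        using div DS D S by (auto simp: AE_restrict_space_iff fmeasurableD)
      moreover have "AE p in lebesgue_on D. p \<in> D"
        using D by (auto simp: AE_restrict_space_iff fmeasurableD)
      ultimately have "AE p in lebesgue_on D. \<bar>u n p + w p - f p\<bar> \<le> norm (u n p - f p)
          + (R - 1) * (norm (grad (u n) p - f' p) + norm (grad (v n) p - g' p))"
      proof eventually_elim
        case (elim p)
        \<comment> \<open>Subtracting the vanishing weak divergence rewrites the divergence of the
          approximation in terms of gradient errors.\<close>
        have "fst (f' p) + snd (g' p) = 0"
          using elim(1) by (simp add: weak_div_def f_def f'_def g_def g'_def)
        then have "fst (grad (u n) p - f' p) + snd (grad (v n) p - g' p)
          = fst (grad (u n) p) + snd (grad (v n) p)"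
          by simp
        then have "w p = (fst p - 1) * (fst (grad (u n) p - f' p) + snd (grad (v n) p - g' p))"
          by (simp only: w_def)
        also have "\<bar>\<dots>\<bar> \<le> (R - 1) * (norm (grad (u n) p - f' p) + norm (grad (v n) p - g' p))"
          unfolding abs_mult
        proof (rule mult_mono)
          show "\<bar>fst p - 1\<bar> \<le> R - 1"
            using elim(2) by (cases p) (auto simp: D_def box_plane)
          show "\<bar>fst (grad (u n) p - f' p) + snd (grad (v n) p - g' p)\<bar>
            \<le> norm (grad (u n) p - f' p) + norm (grad (v n) p - g' p)"
            using norm_fst_le[of "fst (grad (u n) p - f' p)" "snd (grad (u n) p - f' p)"]
              norm_snd_le[of "snd (grad (v n) p - g' p)" "fst (grad (v n) p - g' p)"]
            unfolding real_norm_def prod.collapse by linarith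
        qed (use \<open>R > 1\<close> in auto)
        finally show ?case unfolding real_norm_def by linarith
      qed
      then have "(LINT p|lebesgue_on D. \<bar>u n p + w p - f p\<bar>) \<le>
         (LINT p|lebesgue_on D. norm (u n p - f p)
          + (R - 1) * (norm (grad (u n) p - f' p) + norm (grad (v n) p - g' p)))"
        using int iu iw igrad by (intro integral_mono_AE) auto
      also have "\<dots> = A n + (R - 1) * (B n + C n)"
        using int iu igrad by (simp add: A_def B_def C_def)
      finally show ?thesis
        using integral_abs_bound[of "lebesgue_on D" "\<lambda>p. u n p + w p - f p"] by linarith
    qed
    moreover have "\<bar>(R - 1) * (I1 - 2 * h * U)\<bar> \<le> (R - 1) * E n"
    proof -
      have "I1 - 2 * h * U = integral {-h..h} (\<lambda>y. u n (R, y) - U)"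
        unfolding I1_def using cu \<open>h > 0\<close>
        by (subst Henstock_Kurzweil_Integration.integral_diff)
          (auto intro!: integrable_continuous_real)
      also have "norm \<dots> \<le> E n"
        unfolding E_def using cu
        by (intro integral_norm_bound_integral integrable_continuous_real continuous_intros) auto
      finally show ?thesis using \<open>R > 1\<close> by (simp add: abs_mult)
    qed
    moreover have "\<bar>I2\<bar> \<le> (R - 1) * (T n + L n)"
    proof -
      have "norm I2 \<le> integral {1..R} (\<lambda>x. (R - 1) * (\<bar>v n (x, h)\<bar> + \<bar>v n (x, -h)\<bar>))"
        unfolding I2_def
        by (intro integral_norm_bound_integral integrable_continuous_real continuous_intros cv)
          (auto simp: abs_mult intro!: mult_mono)
      \<comment> \<open>The integrand is nonnegative, so the interval may grow to the full side,
        over which \<open>T\<close> and \<open>L\<close> are taken.\<close>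
      also have "\<dots> \<le> integral {-R..R} (\<lambda>x. (R - 1) * (\<bar>v n (x, h)\<bar> + \<bar>v n (x, -h)\<bar>))"
        using \<open>R > 1\<close>
        by (intro integral_subset_le integrable_continuous_real continuous_intros cv) auto
      also have "\<dots> = (R - 1) * (T n + L n)"
        unfolding T_def L_def using cv
        by (subst Henstock_Kurzweil_Integration.integral_add[symmetric])
          (auto intro!: integrable_continuous_real continuous_intros)
      finally show ?thesis by simp
    qed
    ultimately show ?thesis by linarith
  qed
  moreover have "(\<lambda>n. (A n + (R - 1) * (B n + C n)) + (R - 1) * E n + (R - 1) * (T n + L n))
      \<longlonglongrightarrow> (0 + (R - 1) * (0 + 0)) + (R - 1) * 0 + (R - 1) * (0 + 0)"
    by (intro tendsto_intros A B C E T L)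
  ultimately have "\<bar>d\<bar> \<le> 0"
    using LIMSEQ_le_const by fastforce
  then show ?thesis by (simp add: d_def f_def)
qed

section \<open>The lower bound for the quotient\<close>

theorem theorem4p3:
  fixes h U :: real and \<Psi> :: "real \<Rightarrow> real \<times> real \<Rightarrow> real \<times> real"
  assumes "h > 1" and "U > 0"
    and "\<And>R. R > 1 \<Longrightarrow> in_H1_field (\<Omega> h R) (\<Psi> R)"
    and "\<And>R. R > 1 \<Longrightarrow> AE x in lebesgue_on (\<Omega> h R). weak_div (\<Omega> h R) (\<Psi> R) x = 0"
    and "\<And>R. R > 1 \<Longrightarrow> has_trace_field (\<Omega> h R) (bdry_Q h R) (\<Psi> R) (\<lambda>_. (U, 0))"
    and "\<And>R. R > 1 \<Longrightarrow> has_trace_field (\<Omega> h R) bdry_disk (\<Psi> R) (\<lambda>_. (0, 0))"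
  shows "Liminf at_top (\<lambda>R::real.
           (Lp_norm 2 (lebesgue_on (\<Omega> h R)) (weak_jacobian (\<Omega> h R) (\<Psi> R))
            + Lp_norm 4 (lebesgue_on (\<Omega> h R)) (\<Psi> R)) / ennreal (root 4 R)) > 0"
proof -
  \<comment> \<open>If the L^4 norm is infinite the bound is trivial; otherwise \<open>N\<close> is
    its value. From \<open>R \<ge> 2\<close> on, the area \<open>m\<close> of \<open>D\<close> is at
    least \<open>R\<close>.\<close>
  have bound: "ennreal (U * root 4 R) \<le> Lp_norm 4 (lebesgue_on (\<Omega> h R)) (\<Psi> R)" if "R \<ge> 2" for R
  proof (cases "Lp_norm 4 (lebesgue_on (\<Omega> h R)) (\<Psi> R)")
    case (real N)
    let ?S = "\<Omega> h R"
    define D where "D = box (1, -h) (R, h)"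
    define m where "m = 2 * h * (R - 1)"
    have "R \<le> 2 * (R - 1)" using that by simp
    also have "\<dots> \<le> m"
      unfolding m_def using \<open>h > 1\<close> that by (intro mult_right_mono) auto
    finally have m: "R \<le> m" "m > 0" using that by auto
    have H1: "in_H1_field ?S (\<Psi> R)" using assms(3) that by simp
    have S: "?S \<in> sets lebesgue" by (rule \<Omega>_sets_lebesgue)
    have D: "D \<in> lmeasurable" unfolding D_def by simp
    have DS: "D \<subseteq> ?S" unfolding D_def by (rule box_subset_\<Omega>)
    have mD: "emeasure (lebesgue_on D) (space (lebesgue_on D)) = ennreal m"
    proof -
      have "emeasure lebesgue D = emeasure lborel ({1<..<R} \<times> {-h<..<h})"
        by (simp add: D_def box_plane open_Times borel_open)
      also have "\<dots> = ennreal (R - 1) * ennreal (h - -h)"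
        using that \<open>h > 1\<close>
        by (simp add: lborel_prod[symmetric] lborel.emeasure_pair_measure_Times)
      finally show ?thesis
        using that \<open>h > 1\<close> D
        by (simp add: emeasure_restrict_space fmeasurableD m_def ac_simps flip: ennreal_mult)
    qed
    have meas: "\<Psi> R \<in> borel_measurable (lebesgue_on ?S)"
    proof -
      have "(\<lambda>x. (fst (\<Psi> R x), snd (\<Psi> R x))) \<in> borel_measurable (lebesgue_on ?S)"
        using H1 by (intro borel_measurable_Pair) (auto simp: in_H1_field_def in_H1_def in_Lp_def)
      then show ?thesis by simp
    qed
    have measD: "\<Psi> R \<in> borel_measurable (lebesgue_on D)"
      using measurable_restrict_mono[OF meas DS] .
    have "ennreal (U * m) \<le> (\<integral>\<^sup>+x. ennreal (norm (fst (\<Psi> R x))) \<partial>lebesgue_on D)"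
    proof -
      have "integrable (lebesgue_on D) (\<lambda>x. fst (\<Psi> R x))"
        using H1 by (intro integrable_subset_if_in_Lp_2[OF _ S D DS])
          (simp add: in_H1_field_def in_H1_def)
      then have "ennreal (norm (LINT x|lebesgue_on D. fst (\<Psi> R x)))
          \<le> (\<integral>\<^sup>+x. ennreal (norm (fst (\<Psi> R x))) \<partial>lebesgue_on D)"
        by (rule integral_norm_bound_ennreal)
      moreover have "(LINT x|lebesgue_on D. fst (\<Psi> R x)) = U * m"
        unfolding D_def m_def using that assms by (intro flux) auto
      ultimately show ?thesis
        using \<open>U > 0\<close> m by (simp add: abs_mult)
    qed
    also have "\<dots> \<le> (\<integral>\<^sup>+x. ennreal (norm (\<Psi> R x)) \<partial>lebesgue_on D)"
    proof (intro nn_integral_mono ennreal_leI)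
      show "norm (fst (\<Psi> R x)) \<le> norm (\<Psi> R x)" for x
        using norm_fst_le[of "fst (\<Psi> R x)" "snd (\<Psi> R x)"] by simp
    qed
    finally have "ennreal (U * m) ^ 4 \<le> (\<integral>\<^sup>+x. ennreal (norm (\<Psi> R x)) \<partial>lebesgue_on D) ^ 4"
      by (rule power_mono) simp
    also have "\<dots> \<le> (\<integral>\<^sup>+x. ennreal (norm (\<Psi> R x) ^ 4) \<partial>lebesgue_on D) * ennreal m ^ 3"
      using nn_integral_norm_power4_le[OF measD] by (simp only: mD)
    also have "\<dots> \<le> (\<integral>\<^sup>+x. ennreal (norm (\<Psi> R x) ^ 4) \<partial>lebesgue_on ?S) * ennreal m ^ 3"
      using S D DS by (intro mult_right_mono nn_integral_lebesgue_on_mono) (auto simp: fmeasurableD)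
    also have "\<dots> = ennreal N ^ 4 * ennreal m ^ 3"
      using Lp_norm_power[of 4 "lebesgue_on ?S" "\<Psi> R"] real by simp
    finally have "(U * m) ^ 4 \<le> N ^ 4 * m ^ 3"
      using real \<open>U > 0\<close> m by (simp add: ennreal_power flip: ennreal_mult)
    \<comment> \<open>Hoelder costs only three of the four factors \<open>m\<close>; the remaining
      one yields linear growth of \<open>N ^ 4\<close> in \<open>R\<close>.\<close>
    then have "(U ^ 4 * m) * m ^ 3 \<le> N ^ 4 * m ^ 3"
      by (simp add: power_mult_distrib power_numeral_reduce ac_simps)
    then have "U ^ 4 * m \<le> N ^ 4"
      using m by (simp only: mult_le_cancel_right_pos zero_less_power)
    moreover have "U ^ 4 * R \<le> U ^ 4 * m"
      using m by (intro mult_left_mono) auto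
    ultimately have "(U * root 4 R) ^ 4 \<le> N ^ 4"
      using that by (simp add: power_mult_distrib)
    then have "U * root 4 R \<le> N"
      using power_mono_iff[of "U * root 4 R" N 4] real \<open>U > 0\<close> that by simp
    then show ?thesis using real by (simp add: ennreal_leI)
  qed simp
  have "ennreal U \<le> Liminf at_top (\<lambda>R::real.
           (Lp_norm 2 (lebesgue_on (\<Omega> h R)) (weak_jacobian (\<Omega> h R) (\<Psi> R))
            + Lp_norm 4 (lebesgue_on (\<Omega> h R)) (\<Psi> R)) / ennreal (root 4 R))"
  proof (rule Liminf_bounded, rule eventually_mono[OF eventually_ge_at_top[of 2]])
    fix R :: real assume R: "R \<ge> 2"
    let ?J = "Lp_norm 2 (lebesgue_on (\<Omega> h R)) (weak_jacobian (\<Omega> h R) (\<Psi> R))"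
    let ?L = "Lp_norm 4 (lebesgue_on (\<Omega> h R)) (\<Psi> R)"
    have "ennreal U = ennreal (U * root 4 R) / ennreal (root 4 R)"
      using R \<open>U > 0\<close> by (simp add: divide_ennreal)
    \<comment> \<open>Adding the nonnegative gradient norm can only enlarge the quotient, so
      \<open>U\<close> bounds it from below for all \<open>R \<ge> 2\<close>.\<close>
    also have "\<dots> \<le> (?J + ?L) / ennreal (root 4 R)"
      using bound[OF R] by (intro divide_right_mono_ennreal add_increasing) auto
    finally show "ennreal U \<le> (?J + ?L) / ennreal (root 4 R)" .
  qed
  moreover have "0 < ennreal U" using \<open>U > 0\<close> by simp
  ultimately show ?thesis by (rule less_le_trans[rotated])
qed

end
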